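(* Let $n\ge 1$ be such that $\mathcal U(n)=M(n)^\times\cup\{[0]\}$, with the operations induced from $M(n)$, is a hyperfield. Then the hyperfield $\mathcal U(n)$ is hyperbolic if and only if $n=p$ is a prime with $p\ge 7$.
   Context: For a positive integer $n$, $\mathbb Z_n=\mathbb Z/n\mathbb Z$, $\mathbb Z_n^\times$ is its group of units, and $S_n=\{u^2:u\in\mathbb Z_n^\times\}$. $M(n)$ denotes the Marshall quotient of $\mathbb Z_n$ by $S_n$: the underlying set is the quotient of $\mathbb Z_n$ by the equivalence relation $a\sim b\iff as=bt$ for some $s,t\in S_n$; the class of $a$ is written $[a]$. The operations are $[a][b]=[ab]$, $-[a]=[-a]$, and the multivalued addition $[a]+[b]=\{[c]: cr=as+bt\text{ for some }r,s,t\in S_n\}$, with zero $[0]$ and unit $[1]$. $M(n)^\times$ denotes the set of $x\in M(n)$ for which there is $y\in M(n)$ with $xy=[1]$. A (commutative) multiring is $(R,+,\cdot,-,0,1)$ with $+:R\times R\to\mathcal P(R)\setminus\{\emptyset\}$, $\cdot:R\times R\to R$, $-:R\to R$ and $0,1\in R$ such that: $(R,+,-,0)$ is a commutative multigroup, i.e. for all $a,b,c,t$: $c\in a+b$ implies $a\in c+(-b)$ and $b\in(-a)+c$; $b\in a+0$ iff $a=b$; if $x\in a+b$ and $t\in x+c$ for some $x$, then there is $y\in b+c$ with $t\in a+y$; $c\in a+b$ iff $c\in b+a$; moreover $(R,\cdot,1)$ is a commutative monoid, $a\cdot 0=0$ for all $a$, and $c\in a+b$ implies $cd\in ad+bd$.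 A hyperfield is a multiring with $0\neq 1$ in which every non-zero element is invertible (equivalently, for such multirings, one also has $(a+b)d=ad+bd$). "$\mathcal U(n)$ is a hyperfield with the operations induced from $M(n)$" means: $\mathcal U(n)$ contains $[0],[1]$, is closed under product and negation, satisfies $x+y\subseteq\mathcal U(n)$ (sum computed in $M(n)$) for all $x,y\in\mathcal U(n)$, and with the restricted operations is a hyperfield. A multiring $R$ is hyperbolic if $1-1=R$, where $1-1$ denotes the multivalued sum $1+(-1)$. *)

theory Defs
  imports "HOL-Algebra.IntRing"
begin

text \<open>
  The multiplicative part is the library's \<open>monoid\<close> record, so that
  \<^const>\<open>Units\<close> and \<^const>\<open>comm_monoid\<close> apply directly.
\<close>

record 'a multistruct = "'a monoid" +
  mzero :: 'a
  madd :: "'a \<Rightarrow> 'a \<Rightarrow> 'a set"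
  mneg :: "'a \<Rightarrow> 'a"

locale comm_multigroup =
  fixes R :: "('a, 'b) multistruct_scheme" (structure)
  assumes mzero_closed: "mzero R \<in> carrier R"
    and mneg_closed: "a \<in> carrier R \<Longrightarrow> mneg R a \<in> carrier R"
    and madd_closed: "\<lbrakk>a \<in> carrier R; b \<in> carrier R\<rbrakk> \<Longrightarrow> madd R a b \<subseteq> carrier R"
    and madd_nonempty: "\<lbrakk>a \<in> carrier R; b \<in> carrier R\<rbrakk> \<Longrightarrow> madd R a b \<noteq> {}"
    and madd_reverse: "\<lbrakk>a \<in> carrier R; b \<in> carrier R; c \<in> carrier R; c \<in> madd R a b\<rbrakk>
      \<Longrightarrow> a \<in> madd R c (mneg R b) \<and> b \<in> madd R (mneg R a) c"
    and madd_mzero: "\<lbrakk>a \<in> carrier R; b \<in> carrier R\<rbrakk> \<Longrightarrow> b \<in> madd R a (mzero R) \<longleftrightarrow> a = b"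
    and madd_assoc: "\<lbrakk>a \<in> carrier R; b \<in> carrier R; c \<in> carrier R; t \<in> carrier R; x \<in> carrier R;
        x \<in> madd R a b; t \<in> madd R x c\<rbrakk>
      \<Longrightarrow> \<exists>y \<in> carrier R. y \<in> madd R b c \<and> t \<in> madd R a y"
    and madd_comm: "\<lbrakk>a \<in> carrier R; b \<in> carrier R; c \<in> carrier R\<rbrakk>
      \<Longrightarrow> c \<in> madd R a b \<longleftrightarrow> c \<in> madd R b a"

locale multiring = comm_multigroup R + comm_monoid R
  for R :: "('a, 'b) multistruct_scheme" (structure) +
  assumes mult_mzero: "a \<in> carrier R \<Longrightarrow> a \<otimes> mzero R = mzero R"
    and madd_mult: "\<lbrakk>a \<in> carrier R; b \<in> carrier R; c \<in> carrier R; d \<in> carrier R; c \<in> madd R a b\<rbrakk>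
      \<Longrightarrow> c \<otimes> d \<in> madd R (a \<otimes> d) (b \<otimes> d)"

locale hyperfield = multiring R
  for R :: "('a, 'b) multistruct_scheme" (structure) +
  assumes mzero_neq_one: "mzero R \<noteq> \<one>"
    and nonzero_invertible: "\<lbrakk>a \<in> carrier R; a \<noteq> mzero R\<rbrakk> \<Longrightarrow> a \<in> Units R"

definition hyperbolic :: "('a, 'b) multistruct_scheme \<Rightarrow> bool" where
  "hyperbolic R \<longleftrightarrow> madd R \<one>\<^bsub>R\<^esub> (mneg R \<one>\<^bsub>R\<^esub>) = carrier R"

text \<open>
  All axioms above are relativised to the carrier, so restricting the operations
  of \<open>M\<close> to \<open>U\<close> amounts to replacing the carrier; sums of elements of \<open>U\<close> are
  still computed in \<open>M\<close>.
\<close>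

definition induced :: "('a, 'b) multistruct_scheme \<Rightarrow> 'a set \<Rightarrow> ('a, 'b) multistruct_scheme" where
  "induced M U = M\<lparr>carrier := U\<rparr>"

definition hyperfield_with_induced_ops :: "('a, 'b) multistruct_scheme \<Rightarrow> 'a set \<Rightarrow> bool" where
  "hyperfield_with_induced_ops M U \<longleftrightarrow>
     U \<subseteq> carrier M \<and> mzero M \<in> U \<and> \<one>\<^bsub>M\<^esub> \<in> U \<and>
     (\<forall>x \<in> U. \<forall>y \<in> U. x \<otimes>\<^bsub>M\<^esub> y \<in> U) \<and>
     (\<forall>x \<in> U. mneg M x \<in> U) \<and>
     (\<forall>x \<in> U. \<forall>y \<in> U. madd M x y \<subseteq> U) \<and>
     hyperfield (induced M U)"

definition marshall_rel :: "('a, 'b) ring_scheme \<Rightarrow> 'a set \<Rightarrow> ('a \<times> 'a) set" where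
  "marshall_rel A S = {(a, b) \<in> carrier A \<times> carrier A. \<exists>s \<in> S. \<exists>t \<in> S. a \<otimes>\<^bsub>A\<^esub> s = b \<otimes>\<^bsub>A\<^esub> t}"

abbreviation marshall_class :: "('a, 'b) ring_scheme \<Rightarrow> 'a set \<Rightarrow> 'a \<Rightarrow> 'a set" where
  "marshall_class A S a \<equiv> marshall_rel A S `` {a}"

text \<open>
  Product and negation follow the union idiom of \<open>HOL.Equiv_Relations\<close>: every
  member of the union is the same class, see \<open>marshall_mult_class\<close> and
  \<open>marshall_neg_class\<close> below.
\<close>

definition marshall_quotient :: "('a, 'b) ring_scheme \<Rightarrow> 'a set \<Rightarrow> 'a set multistruct" where
  "marshall_quotient A S =
     \<lparr> carrier = carrier A // marshall_rel A S,
       monoid.mult = (\<lambda>X Y. \<Union>a \<in> X. \<Union>b \<in> Y. marshall_class A S (a \<otimes>\<^bsub>A\<^esub> b)),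
       one = marshall_class A S \<one>\<^bsub>A\<^esub>,
       mzero = marshall_class A S \<zero>\<^bsub>A\<^esub>,
       madd = (\<lambda>X Y. {marshall_class A S c | c. c \<in> carrier A \<and>
                 (\<exists>a \<in> X. \<exists>b \<in> Y. \<exists>r \<in> S. \<exists>s \<in> S. \<exists>t \<in> S.
                    c \<otimes>\<^bsub>A\<^esub> r = a \<otimes>\<^bsub>A\<^esub> s \<oplus>\<^bsub>A\<^esub> b \<otimes>\<^bsub>A\<^esub> t)}),
       mneg = (\<lambda>X. \<Union>a \<in> X. marshall_class A S (\<ominus>\<^bsub>A\<^esub> a)) \<rparr>"

locale marshall_pair = cring A for A :: "('a, 'b) ring_scheme" (structure) +
  fixes S :: "'a set"
  assumes S_subset: "S \<subseteq> carrier A"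
    and S_one: "\<one> \<in> S"
    and S_mult: "\<lbrakk>s \<in> S; t \<in> S\<rbrakk> \<Longrightarrow> s \<otimes> t \<in> S"
begin

lemma S_carrier: "s \<in> S \<Longrightarrow> s \<in> carrier A"
  using S_subset by blast

lemma marshall_relI:
  "\<lbrakk>a \<in> carrier A; b \<in> carrier A; s \<in> S; t \<in> S; a \<otimes> s = b \<otimes> t\<rbrakk> \<Longrightarrow> (a, b) \<in> marshall_rel A S"
  unfolding marshall_rel_def by blast

lemma equiv_marshall_rel: "equiv (carrier A) (marshall_rel A S)"
proof (rule equivI)
  show "marshall_rel A S \<subseteq> carrier A \<times> carrier A"
    unfolding marshall_rel_def by auto
  show "refl_on (carrier A) (marshall_rel A S)"
    using S_one by (auto simp: refl_on_def marshall_rel_def)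
  show "sym (marshall_rel A S)"
    by (rule symI) (force simp: marshall_rel_def)
  show "trans (marshall_rel A S)"
  proof (rule transI)
    fix a b c assume "(a, b) \<in> marshall_rel A S" "(b, c) \<in> marshall_rel A S"
    then obtain s t u v where abc: "a \<in> carrier A" "b \<in> carrier A" "c \<in> carrier A"
      and stuv: "s \<in> S" "t \<in> S" "u \<in> S" "v \<in> S"
      and eq: "a \<otimes> s = b \<otimes> t" "b \<otimes> u = c \<otimes> v"
      unfolding marshall_rel_def by blast
    have "a \<otimes> (s \<otimes> u) = (a \<otimes> s) \<otimes> u"
      using abc stuv S_carrier by (simp add: m_assoc)
    also have "\<dots> = (b \<otimes> u) \<otimes> t"
      using abc stuv S_carrier by (simp add: eq(1) m_ac)
    also have "\<dots> = c \<otimes> (v \<otimes> t)"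
      using abc stuv S_carrier by (simp add: eq(2) m_assoc)
    finally show "(a, c) \<in> marshall_rel A S"
      using abc stuv by (intro marshall_relI[of a c "s \<otimes> u" "v \<otimes> t"]) (auto intro: S_mult)
  qed
qed

lemma marshall_mult_class:
  assumes "a \<in> carrier A" "b \<in> carrier A"
  shows "marshall_class A S a \<otimes>\<^bsub>marshall_quotient A S\<^esub> marshall_class A S b
    = marshall_class A S (a \<otimes> b)"
proof -
  have "congruent2 (marshall_rel A S) (marshall_rel A S) (\<lambda>a b. marshall_class A S (a \<otimes> b))"
  proof (rule congruent2_commuteI[OF equiv_marshall_rel])
    fix y z assume "y \<in> carrier A" "z \<in> carrier A"
    then show "marshall_class A S (y \<otimes> z) = marshall_class A S (z \<otimes> y)"
      by (simp add: m_comm)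
  next
    fix y z w assume w: "w \<in> carrier A" and "(y, z) \<in> marshall_rel A S"
    then obtain s t where yz: "y \<in> carrier A" "z \<in> carrier A" "s \<in> S" "t \<in> S" "y \<otimes> s = z \<otimes> t"
      unfolding marshall_rel_def by blast
    have "(w \<otimes> y) \<otimes> s = (w \<otimes> z) \<otimes> t"
      using w yz S_carrier by (simp add: m_assoc)
    then have "(w \<otimes> y, w \<otimes> z) \<in> marshall_rel A S"
      using w yz by (intro marshall_relI) auto
    then show "marshall_class A S (w \<otimes> y) = marshall_class A S (w \<otimes> z)"
      by (rule equiv_class_eq[OF equiv_marshall_rel])
  qed
  then show ?thesis
    using UN_equiv_class2[OF equiv_marshall_rel equiv_marshall_rel _ assms]
    by (simp add: marshall_quotient_def)
qed

lemma marshall_neg_class: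
  assumes "a \<in> carrier A"
  shows "mneg (marshall_quotient A S) (marshall_class A S a) = marshall_class A S (\<ominus> a)"
proof -
  have "congruent (marshall_rel A S) (\<lambda>a. marshall_class A S (\<ominus> a))"
  proof (rule congruentI)
    fix y z assume "(y, z) \<in> marshall_rel A S"
    then obtain s t where yz: "y \<in> carrier A" "z \<in> carrier A" "s \<in> S" "t \<in> S" "y \<otimes> s = z \<otimes> t"
      unfolding marshall_rel_def by blast
    have "(\<ominus> y) \<otimes> s = (\<ominus> z) \<otimes> t"
      using yz S_carrier by (simp add: l_minus)
    then have "(\<ominus> y, \<ominus> z) \<in> marshall_rel A S"
      using yz by (intro marshall_relI) auto
    then show "marshall_class A S (\<ominus> y) = marshall_class A S (\<ominus> z)"
      by (rule equiv_class_eq[OF equiv_marshall_rel])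
  qed
  then show ?thesis
    using UN_equiv_class[OF equiv_marshall_rel _ assms] by (simp add: marshall_quotient_def)
qed

lemma marshall_add_class:
  assumes a: "a \<in> carrier A" and b: "b \<in> carrier A"
  shows "madd (marshall_quotient A S) (marshall_class A S a) (marshall_class A S b) =
    {marshall_class A S c | c. c \<in> carrier A \<and>
       (\<exists>r \<in> S. \<exists>s \<in> S. \<exists>t \<in> S. c \<otimes> r = a \<otimes> s \<oplus> b \<otimes> t)}" (is "?L = ?R")
proof
  have "a \<in> marshall_class A S a" "b \<in> marshall_class A S b"
    using a b equiv_class_self[OF equiv_marshall_rel] by auto
  then show "?R \<subseteq> ?L"
    unfolding marshall_quotient_def by fastforce
next
  show "?L \<subseteq> ?R"
  proof
    fix X assume "X \<in> ?L"
    then obtain c a' b' r s t where X: "X = marshall_class A S c" and c: "c \<in> carrier A"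
      and a': "(a, a') \<in> marshall_rel A S" and b': "(b, b') \<in> marshall_rel A S"
      and rst: "r \<in> S" "s \<in> S" "t \<in> S" and eq: "c \<otimes> r = a' \<otimes> s \<oplus> b' \<otimes> t"
      unfolding marshall_quotient_def by auto
    obtain u v where uv: "u \<in> S" "v \<in> S" "a \<otimes> u = a' \<otimes> v" and a'c: "a' \<in> carrier A"
      using a' unfolding marshall_rel_def by blast
    obtain w z where wz: "w \<in> S" "z \<in> S" "b \<otimes> w = b' \<otimes> z" and b'c: "b' \<in> carrier A"
      using b' unfolding marshall_rel_def by blast
    note cl = a b c a'c b'c rst[THEN S_carrier] uv(1,2)[THEN S_carrier] wz(1,2)[THEN S_carrier]
    have "c \<otimes> (r \<otimes> (v \<otimes> z)) = (c \<otimes> r) \<otimes> (v \<otimes> z)"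
      using cl by (simp add: m_assoc)
    also have "\<dots> = (a' \<otimes> s) \<otimes> (v \<otimes> z) \<oplus> (b' \<otimes> t) \<otimes> (v \<otimes> z)"
      using cl by (simp add: eq l_distr)
    also have "\<dots> = (a' \<otimes> v) \<otimes> (s \<otimes> z) \<oplus> (b' \<otimes> z) \<otimes> (t \<otimes> v)"
      using cl by (simp add: m_ac)
    also have "\<dots> = a \<otimes> (u \<otimes> (s \<otimes> z)) \<oplus> b \<otimes> (w \<otimes> (t \<otimes> v))"
      using cl by (simp add: uv(3)[symmetric] wz(3)[symmetric] m_assoc)
    finally have "c \<otimes> (r \<otimes> (v \<otimes> z)) = a \<otimes> (u \<otimes> (s \<otimes> z)) \<oplus> b \<otimes> (w \<otimes> (t \<otimes> v))" .
    moreover have "r \<otimes> (v \<otimes> z) \<in> S" "u \<otimes> (s \<otimes> z) \<in> S" "w \<otimes> (t \<otimes> v) \<in> S"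
      using rst uv wz by (auto intro: S_mult)
    ultimately show "X \<in> ?R"
      using X c by blast
  qed
qed

end

definition unit_squares :: "('a, 'b) ring_scheme \<Rightarrow> 'a set" where
  "unit_squares A = {u \<otimes>\<^bsub>A\<^esub> u | u. u \<in> Units A}"

lemma (in cring) marshall_pair_unit_squares: "marshall_pair R (unit_squares R)"
proof
  show "unit_squares R \<subseteq> carrier R"
    by (auto simp: unit_squares_def)
  show "\<one> \<in> unit_squares R"
    unfolding unit_squares_def using Units_one_closed by force
  fix s t assume "s \<in> unit_squares R" "t \<in> unit_squares R"
  then obtain u v where uv: "u \<in> Units R" "v \<in> Units R" "s = u \<otimes> u" "t = v \<otimes> v"
    unfolding unit_squares_def by blast
  then have "s \<otimes> t = (u \<otimes> v) \<otimes> (u \<otimes> v)"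
    by (simp add: Units_closed m_ac)
  then show "s \<otimes> t \<in> unit_squares R"
    unfolding unit_squares_def using uv Units_m_closed by blast
qed

text \<open>
  \<^term>\<open>ZFact (int n)\<close> is the quotient ring \<open>\<int>/n\<int>\<close>; its elements are cosets, so the
  elements of \<open>M_mod n\<close> are sets of cosets.
\<close>

definition M_mod :: "nat \<Rightarrow> int set set multistruct" where
  "M_mod n = marshall_quotient (ZFact (int n)) (unit_squares (ZFact (int n)))"

definition U_mod :: "nat \<Rightarrow> int set set set" where
  "U_mod n = Units (M_mod n) \<union> {mzero (M_mod n)}"

end

theory Submission
  imports Defs "HOL-Number_Theory.Cong"
begin

text \<open>
  In a Marshall quotient by squares of units, the class of \<open>a\<close> lies in \<open>1 - 1\<close> exactly when some
  multiple of \<open>a\<close> by a unit square is a difference of two unit squares. So everything can be read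
  in \<open>\<int>\<close>: call \<open>x\<close> good (\<open>unit_square_difference\<close>) if \<open>x u\<^sup>2 \<equiv> v\<^sup>2 - w\<^sup>2\<close> modulo \<open>n\<close> with
  \<open>u, v, w\<close> coprime to \<open>n\<close>. Closure of \<open>\<U>(n)\<close> under addition forces each good \<open>x\<close> to be
  coprime to \<open>n\<close> or divisible by \<open>n\<close>, and \<open>\<U>(n)\<close> is hyperbolic exactly when, conversely, each such \<open>x\<close> is good.

  If \<open>\<U>(n)\<close> is hyperbolic, then \<open>1\<close> is good, so \<open>u\<^sup>2 + w\<^sup>2 \<equiv> v\<^sup>2\<close> is solvable in units. It is not
  solvable modulo 2, 3 or 5, where the only unit squares are \<open>1\<close> and, modulo 5, also \<open>-1\<close>; hence every
  prime factor of \<open>n\<close> is at least 7 (\<open>unit_pythagorean_imp_prime_ge_7\<close>). If moreover \<open>n = p d\<close> with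
  \<open>p\<close> prime and \<open>d > 1\<close>, then for a suitable sign the number \<open>1 \<plusminus> d\<close> is a unit whose square minus
  \<open>1\<close> is divisible by \<open>d\<close> but not by \<open>n\<close>, against closure (\<open>composite_nonunit_square_difference\<close>).

  If \<open>p \<ge> 7\<close> is prime, the identity \<open>4 x = (x + 1)\<^sup>2 - (x - 1)\<^sup>2\<close> shows that \<open>x\<close> is good unless
  \<open>x \<equiv> \<plusminus>1\<close>, and these two cases follow from \<open>4\<^sup>2 = 5\<^sup>2 - 3\<^sup>2\<close>
  (\<open>prime_ge_7_square_difference\<close>).
\<close>

section \<open>Marshall quotients by multiplicative sets of units\<close>

context marshall_pair
begin

lemma marshall_class_eq_iff:
  assumes "a \<in> carrier A" "b \<in> carrier A"
  shows "marshall_class A S a = marshall_class A S b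
    \<longleftrightarrow> (\<exists>s \<in> S. \<exists>t \<in> S. a \<otimes> s = b \<otimes> t)"
  using eq_equiv_class_iff[OF equiv_marshall_rel assms] assms
  by (simp add: marshall_rel_def)

lemma marshall_class_closed:
  "a \<in> carrier A \<Longrightarrow> marshall_class A S a \<in> carrier (marshall_quotient A S)"
  by (simp add: marshall_quotient_def quotientI)

lemma one_marshall_quotient: "\<one>\<^bsub>marshall_quotient A S\<^esub> = marshall_class A S \<one>"
  by (simp add: marshall_quotient_def)

lemma marshall_class_cases:
  assumes "X \<in> carrier (marshall_quotient A S)"
  obtains a where "a \<in> carrier A" "X = marshall_class A S a"
  using assms by (auto simp: marshall_quotient_def elim: quotientE)

text \<open>
  If \<open>S\<close> consists of units, multiplying by elements of \<open>S\<close> can be undone, so passing to the quotient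
  neither kills a nonzero element nor makes a non-unit invertible.
\<close>
lemma marshall_class_eq_mzero_iff:
  assumes "S \<subseteq> Units A" and a: "a \<in> carrier A"
  shows "marshall_class A S a = mzero (marshall_quotient A S) \<longleftrightarrow> a = \<zero>"
proof -
  have "a = \<zero>" if s: "s \<in> S" and t: "t \<in> S" and eq: "a \<otimes> s = \<zero> \<otimes> t" for s t
  proof -
    have u: "s \<in> Units A"
      using s assms by blast
    have "a = a \<otimes> s \<otimes> inv s"
      using u a by (simp add: m_assoc Units_closed)
    also have "\<dots> = \<zero>"
      using u t by (simp add: eq S_carrier)
    finally show ?thesis .
  qed
  then show ?thesis
    using marshall_class_eq_iff[OF a zero_closed] S_one by (auto simp: marshall_quotient_def)
qed

lemma marshall_class_in_Units_iff:
  assumes "S \<subseteq> Units A" and a: "a \<in> carrier A"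
  shows "marshall_class A S a \<in> Units (marshall_quotient A S) \<longleftrightarrow> a \<in> Units A"
proof
  assume "marshall_class A S a \<in> Units (marshall_quotient A S)"
  then obtain Y where "Y \<in> carrier (marshall_quotient A S)"
    and "marshall_class A S a \<otimes>\<^bsub>marshall_quotient A S\<^esub> Y = marshall_class A S \<one>"
    unfolding Units_def one_marshall_quotient by blast
  then obtain b where b: "b \<in> carrier A" and "marshall_class A S (a \<otimes> b) = marshall_class A S \<one>"
    using a by (metis marshall_class_cases marshall_mult_class)
  then obtain s t where st: "s \<in> S" "t \<in> S" and eq: "a \<otimes> b \<otimes> s = \<one> \<otimes> t"
    using a by (auto simp: marshall_class_eq_iff)
  have t: "t \<in> Units A"
    using st assms by blast
  have "a \<otimes> (b \<otimes> s \<otimes> inv t) = (a \<otimes> b \<otimes> s) \<otimes> inv t"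
    using a b st t by (simp add: m_assoc S_carrier)
  also have "\<dots> = \<one>"
    using t by (simp add: eq Units_closed)
  finally have "a \<otimes> (b \<otimes> s \<otimes> inv t) = \<one>" .
  moreover have "b \<otimes> s \<otimes> inv t \<in> carrier A"
    using b st t by (simp add: S_carrier)
  ultimately show "a \<in> Units A"
    using a unfolding Units_def
    by (auto simp: m_comm intro!: bexI[of _ "b \<otimes> s \<otimes> inv t"])
next
  assume "a \<in> Units A"
  then obtain b where "b \<in> carrier A" "b \<otimes> a = \<one>" "a \<otimes> b = \<one>"
    by (auto simp: Units_def)
  then show "marshall_class A S a \<in> Units (marshall_quotient A S)"
    using a unfolding Units_def one_marshall_quotient
    by (auto simp: marshall_mult_class intro!: marshall_class_closed
        exI[of _ "marshall_class A S b"] bexI[of _ "marshall_class A S b"])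
qed

text \<open>
  A class belongs to \<open>1 - 1\<close> when one of its representatives does; clearing the factors from \<open>S\<close> that
  relate two representatives shows that the condition can be tested on any of them.
\<close>
lemma marshall_class_in_one_minus_one_iff:
  assumes a: "a \<in> carrier A"
  shows "marshall_class A S a \<in> madd (marshall_quotient A S) \<one>\<^bsub>marshall_quotient A S\<^esub>
      (mneg (marshall_quotient A S) \<one>\<^bsub>marshall_quotient A S\<^esub>)
    \<longleftrightarrow> (\<exists>r \<in> S. \<exists>s \<in> S. \<exists>t \<in> S. a \<otimes> r = s \<ominus> t)"
    (is "?L \<longleftrightarrow> ?R")
proof -
  have diff: "\<one> \<otimes> s \<oplus> (\<ominus> \<one>) \<otimes> t = s \<ominus> t" if "s \<in> S" "t \<in> S" for s t
    using that by (simp add: S_carrier l_minus minus_eq)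
  have "?L \<longleftrightarrow> (\<exists>c \<in> carrier A. marshall_class A S a = marshall_class A S c \<and>
      (\<exists>r \<in> S. \<exists>s \<in> S. \<exists>t \<in> S. c \<otimes> r = s \<ominus> t))"
    unfolding one_marshall_quotient by (auto simp: marshall_neg_class marshall_add_class diff)
  also have "\<dots> \<longleftrightarrow> ?R"
  proof
    assume "\<exists>c \<in> carrier A. marshall_class A S a = marshall_class A S c \<and>
      (\<exists>r \<in> S. \<exists>s \<in> S. \<exists>t \<in> S. c \<otimes> r = s \<ominus> t)"
    then obtain c r s t u v where c: "c \<in> carrier A"
      and rst: "r \<in> S" "s \<in> S" "t \<in> S" "u \<in> S" "v \<in> S"
      and eq: "c \<otimes> r = s \<ominus> t" "a \<otimes> u = c \<otimes> v"
      using a by (auto simp: marshall_class_eq_iff)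
    note cl = a c rst[THEN S_carrier]
    have "a \<otimes> (u \<otimes> r) = (a \<otimes> u) \<otimes> r"
      using cl by (simp add: m_assoc)
    also have "\<dots> = (c \<otimes> r) \<otimes> v"
      using cl by (simp add: eq(2) m_ac)
    also have "\<dots> = s \<otimes> v \<ominus> t \<otimes> v"
      using cl by (simp add: eq(1) minus_eq l_distr l_minus)
    finally show ?R
      using rst by (blast intro: S_mult)
  next
    assume R: ?R
    show "\<exists>c \<in> carrier A. marshall_class A S a = marshall_class A S c \<and>
      (\<exists>r \<in> S. \<exists>s \<in> S. \<exists>t \<in> S. c \<otimes> r = s \<ominus> t)"
      using R a by metis
  qed
  finally show ?thesis .
qed

end

section \<open>Translation to congruences\<close>

definition unit_square_difference :: "nat \<Rightarrow> int \<Rightarrow> bool" where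
  "unit_square_difference n x \<longleftrightarrow> (\<exists>u v w. coprime u (int n) \<and> coprime v (int n) \<and>
     coprime w (int n) \<and> [x * u\<^sup>2 = v\<^sup>2 - w\<^sup>2] (mod int n))"

lemma ring_hom_cring_ZMod: "ring_hom_cring \<Z> (ZFact k) (ZMod k)"
proof -
  interpret ideal "Idl\<^bsub>\<Z>\<^esub> {k}" \<Z>
    by (rule int.genideal_ideal) simp
  have "ZMod k = (+>\<^bsub>\<Z>\<^esub>) (Idl\<^bsub>\<Z>\<^esub> {k})"
    by (rule ext) (simp add: ZMod_def)
  then show ?thesis
    using rcos_ring_hom_cring[OF int_is_cring] by (simp add: ZFact_def)
qed

lemma ZMod_closed: "ZMod k x \<in> carrier (ZFact k)"
proof -
  interpret ZMod: ring_hom_cring \<Z> "ZFact k" "ZMod k"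
    by (rule ring_hom_cring_ZMod)
  show ?thesis
    using ZMod.hom_closed by simp
qed

lemma ZFact_cases:
  assumes "a \<in> carrier (ZFact k)"
  obtains x where "a = ZMod k x"
  using assms by (auto simp: ZFact_def ZMod_def FactRing_def A_RCOSETS_def' a_r_coset_def)

lemma ZMod_eq_iff_cong: "ZMod k x = ZMod k y \<longleftrightarrow> [x = y] (mod k)"
  by (simp add: ZMod_eq_mod cong_def)

lemma ZMod_mult: "ZMod k x \<otimes>\<^bsub>ZFact k\<^esub> ZMod k y = ZMod k (x * y)"
proof -
  interpret ZMod: ring_hom_cring \<Z> "ZFact k" "ZMod k"
    by (rule ring_hom_cring_ZMod)
  show ?thesis
    using ZMod.hom_mult[of x y] by simp
qed

lemma ZMod_diff: "ZMod k x \<ominus>\<^bsub>ZFact k\<^esub> ZMod k y = ZMod k (x - y)"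
proof -
  interpret ZMod: ring_hom_cring \<Z> "ZFact k" "ZMod k"
    by (rule ring_hom_cring_ZMod)
  show ?thesis
    using ZMod.hom_add[of x "- y"] ZMod.hom_a_inv[of y] by (simp add: a_minus_def)
qed

lemma ZMod_one: "\<one>\<^bsub>ZFact k\<^esub> = ZMod k 1"
proof -
  interpret ZMod: ring_hom_cring \<Z> "ZFact k" "ZMod k"
    by (rule ring_hom_cring_ZMod)
  show ?thesis
    using ZMod.hom_one by simp
qed

lemma ZMod_zero: "\<zero>\<^bsub>ZFact k\<^esub> = ZMod k 0"
proof -
  interpret ZMod: ring_hom_cring \<Z> "ZFact k" "ZMod k"
    by (rule ring_hom_cring_ZMod)
  show ?thesis
    using ZMod.hom_zero by simp
qed

lemma ZMod_in_Units_iff: "ZMod k x \<in> Units (ZFact k) \<longleftrightarrow> coprime x k"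
proof -
  have "ZMod k x \<in> Units (ZFact k) \<longleftrightarrow> (\<exists>y. [x * y = 1] (mod k))"
  proof
    assume "ZMod k x \<in> Units (ZFact k)"
    then obtain b where "b \<in> carrier (ZFact k)" "ZMod k x \<otimes>\<^bsub>ZFact k\<^esub> b = ZMod k 1"
      by (auto simp: Units_def ZMod_one)
    moreover from this(1) obtain y where "b = ZMod k y"
      by (rule ZFact_cases)
    ultimately show "\<exists>y. [x * y = 1] (mod k)"
      by (auto simp: ZMod_mult ZMod_eq_iff_cong)
  next
    assume "\<exists>y. [x * y = 1] (mod k)"
    then obtain y where "ZMod k (x * y) = ZMod k 1"
      by (auto simp: ZMod_eq_iff_cong)
    then have "ZMod k y \<otimes>\<^bsub>ZFact k\<^esub> ZMod k x = \<one>\<^bsub>ZFact k\<^esub>"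
      and "ZMod k x \<otimes>\<^bsub>ZFact k\<^esub> ZMod k y = \<one>\<^bsub>ZFact k\<^esub>"
      by (simp_all add: ZMod_mult ZMod_one mult.commute[of y x])
    then show "ZMod k x \<in> Units (ZFact k)"
      unfolding Units_def using ZMod_closed by blast
  qed
  then show ?thesis
    by (simp add: coprime_iff_invertible_int)
qed

lemma in_unit_squares_ZFact_iff:
  "s \<in> unit_squares (ZFact k) \<longleftrightarrow> (\<exists>u. coprime u k \<and> s = ZMod k (u\<^sup>2))"
proof
  assume "s \<in> unit_squares (ZFact k)"
  then obtain a where a: "a \<in> Units (ZFact k)" "s = a \<otimes>\<^bsub>ZFact k\<^esub> a"
    unfolding unit_squares_def by blast
  moreover obtain u where "a = ZMod k u"
    using a(1) by (auto simp: Units_def elim: ZFact_cases)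
  ultimately show "\<exists>u. coprime u k \<and> s = ZMod k (u\<^sup>2)"
    by (auto simp: ZMod_mult ZMod_in_Units_iff power2_eq_square)
next
  assume "\<exists>u. coprime u k \<and> s = ZMod k (u\<^sup>2)"
  then obtain u where "ZMod k u \<in> Units (ZFact k)" "s = ZMod k u \<otimes>\<^bsub>ZFact k\<^esub> ZMod k u"
    by (auto simp: ZMod_mult power2_eq_square ZMod_in_Units_iff)
  then show "s \<in> unit_squares (ZFact k)"
    unfolding unit_squares_def by blast
qed

definition M_class :: "nat \<Rightarrow> int \<Rightarrow> int set set" where
  "M_class n x = marshall_class (ZFact (int n)) (unit_squares (ZFact (int n))) (ZMod (int n) x)"

lemma marshall_pair_ZFact: "marshall_pair (ZFact k) (unit_squares (ZFact k))"
  by (rule cring.marshall_pair_unit_squares[OF ZFact_is_cring])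

lemma unit_squares_ZFact_subset: "unit_squares (ZFact k) \<subseteq> Units (ZFact k)"
  by (auto simp: in_unit_squares_ZFact_iff ZMod_in_Units_iff)

lemma M_mod_cases:
  assumes "X \<in> carrier (M_mod n)"
  obtains x where "X = M_class n x"
proof -
  interpret marshall_pair "ZFact (int n)" "unit_squares (ZFact (int n))"
    by (rule marshall_pair_ZFact)
  from assms obtain a where a: "a \<in> carrier (ZFact (int n))"
    and X: "X = marshall_class (ZFact (int n)) (unit_squares (ZFact (int n))) a"
    unfolding M_mod_def by (rule marshall_class_cases)
  from a obtain x where "a = ZMod (int n) x"
    by (rule ZFact_cases)
  with X have "X = M_class n x"
    by (simp add: M_class_def)
  then show ?thesis
    by (rule that)
qed

lemma M_class_in_U_mod_iff: "M_class n x \<in> U_mod n \<longleftrightarrow> coprime x (int n) \<or> int n dvd x"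
  using marshall_pair.marshall_class_in_Units_iff[OF marshall_pair_ZFact unit_squares_ZFact_subset
      ZMod_closed, of "int n" x]
    marshall_pair.marshall_class_eq_mzero_iff[OF marshall_pair_ZFact unit_squares_ZFact_subset
      ZMod_closed, of "int n" x]
  by (auto simp: U_mod_def M_mod_def M_class_def ZMod_in_Units_iff ZMod_zero ZMod_eq_iff_cong
      cong_0_iff)

lemma M_class_in_one_minus_one_iff:
  "M_class n x \<in> madd (M_mod n) \<one>\<^bsub>M_mod n\<^esub> (mneg (M_mod n) \<one>\<^bsub>M_mod n\<^esub>)
    \<longleftrightarrow> unit_square_difference n x"
proof -
  let ?S = "unit_squares (ZFact (int n))"
  have Bex_S: "(\<exists>s \<in> ?S. P s) \<longleftrightarrow> (\<exists>u. coprime u (int n) \<and> P (ZMod (int n) (u\<^sup>2)))" for P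
    unfolding Bex_def in_unit_squares_ZFact_iff by blast
  show ?thesis
    unfolding M_mod_def M_class_def unit_square_difference_def
      marshall_pair.marshall_class_in_one_minus_one_iff[OF marshall_pair_ZFact ZMod_closed] Bex_S
    by (auto simp: ZMod_mult ZMod_diff ZMod_eq_iff_cong)
qed

lemma U_mod_closed_imp:
  assumes "hyperfield_with_induced_ops (M_mod n) (U_mod n)" "unit_square_difference n x"
  shows "coprime x (int n) \<or> int n dvd x"
proof -
  have "madd (M_mod n) \<one>\<^bsub>M_mod n\<^esub> (mneg (M_mod n) \<one>\<^bsub>M_mod n\<^esub>) \<subseteq> U_mod n"
    using assms(1) by (simp add: hyperfield_with_induced_ops_def)
  then show ?thesis
    using assms(2) M_class_in_one_minus_one_iff M_class_in_U_mod_iff by blast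
qed

lemma hyperbolic_U_mod_iff:
  assumes "hyperfield_with_induced_ops (M_mod n) (U_mod n)"
  shows "hyperbolic (induced (M_mod n) (U_mod n)) \<longleftrightarrow>
    (\<forall>x. coprime x (int n) \<or> int n dvd x \<longrightarrow> unit_square_difference n x)"
proof -
  let ?D = "madd (M_mod n) \<one>\<^bsub>M_mod n\<^esub> (mneg (M_mod n) \<one>\<^bsub>M_mod n\<^esub>)"
  have "?D \<subseteq> U_mod n" and U: "U_mod n \<subseteq> carrier (M_mod n)"
    using assms by (simp_all add: hyperfield_with_induced_ops_def)
  then have "hyperbolic (induced (M_mod n) (U_mod n)) \<longleftrightarrow> U_mod n \<subseteq> ?D"
    by (auto simp: hyperbolic_def induced_def)
  also have "\<dots> \<longleftrightarrow> (\<forall>x. M_class n x \<in> U_mod n \<longrightarrow> M_class n x \<in> ?D)"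
  proof
    assume *: "\<forall>x. M_class n x \<in> U_mod n \<longrightarrow> M_class n x \<in> ?D"
    show "U_mod n \<subseteq> ?D"
    proof
      fix X assume X: "X \<in> U_mod n"
      then obtain x where "X = M_class n x"
        using U M_mod_cases[of X n] by blast
      with X * show "X \<in> ?D"
        by simp
    qed
  qed (rule allI, rule impI, rule subsetD)
  finally show ?thesis
    by (simp add: M_class_in_one_minus_one_iff M_class_in_U_mod_iff)
qed

lemma hyperfield_U_mod_imp_gt_1:
  assumes "hyperfield_with_induced_ops (M_mod n) (U_mod n)" "n \<ge> 1"
  shows "n > 1"
proof -
  have "mzero (M_mod n) \<noteq> \<one>\<^bsub>M_mod n\<^esub>"
    using assms hyperfield.mzero_neq_one[of "induced (M_mod n) (U_mod n)"]
    by (simp add: hyperfield_with_induced_ops_def induced_def)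
  moreover have "mzero (M_mod n) = M_class n 0" "\<one>\<^bsub>M_mod n\<^esub> = M_class n 1"
    by (simp_all add: M_mod_def M_class_def marshall_quotient_def ZMod_zero ZMod_one)
  ultimately have "\<not> [0 = 1] (mod int n)"
    by (auto simp: M_class_def simp flip: ZMod_eq_iff_cong)
  then show ?thesis
    using assms(2) by (cases "n = 1") auto
qed

section \<open>Differences of unit squares modulo an integer\<close>

text \<open>
  Reducing \<open>u\<^sup>2 \<equiv> v\<^sup>2 - w\<^sup>2\<close> modulo a prime factor \<open>p < 7\<close> leaves finitely many triples of nonzero
  residues, none of which is a solution.
\<close>
lemma unit_pythagorean_imp_prime_ge_7:
  assumes "unit_square_difference n 1" "Factorial_Ring.prime p" "p dvd n"
  shows "p \<ge> 7"
proof (rule ccontr)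
  assume "\<not> p \<ge> 7"
  then have "p \<in> {0,1,2,3,4,5,6}"
    by auto
  moreover have "\<not> Factorial_Ring.prime (4::nat)" "\<not> Factorial_Ring.prime (6::nat)"
    using prime_nat_not_dvd[of 4 2] prime_nat_not_dvd[of 6 2] by auto
  ultimately have p: "p \<in> {2,3,5}"
    using assms(2) by auto
  have dvd: "int p dvd int n"
    using assms(3) by simp
  obtain u v w where co: "coprime u (int n)" "coprime v (int n)" "coprime w (int n)"
    and eq: "[1 * u\<^sup>2 = v\<^sup>2 - w\<^sup>2] (mod int n)"
    using assms(1) unfolding unit_square_difference_def by blast
  have nd: "x mod int p \<noteq> 0" if "coprime x (int n)" for x
    using that dvd assms(2) coprime_common_divisor[of x "int n" "int p"] by auto
  have "int p dvd u\<^sup>2 - (v\<^sup>2 - w\<^sup>2)"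
    using eq dvd by (auto simp: cong_iff_dvd_diff intro: dvd_trans)
  moreover have "[(u mod int p)\<^sup>2 - ((v mod int p)\<^sup>2 - (w mod int p)\<^sup>2) = u\<^sup>2 - (v\<^sup>2 - w\<^sup>2)] (mod int p)"
    by (intro cong_diff cong_pow) simp_all
  ultimately have sum: "((u mod int p)\<^sup>2 - ((v mod int p)\<^sup>2 - (w mod int p)\<^sup>2)) mod int p = 0"
    by (simp add: cong_def)
  have range: "x mod int p \<noteq> 0 \<and> 0 \<le> x mod int p \<and> x mod int p < int p"
    if "coprime x (int n)" for x
    using nd[OF that] p by auto
  have "x mod int p \<in> (if p = 2 then {1} else if p = 3 then {1,2} else {1,2,3,4})"
    if "coprime x (int n)" for x
    using range[OF that] p by (elim insertE emptyE) (simp_all, linarith+)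
  from this[OF co(1)] this[OF co(2)] this[OF co(3)] sum p show False
    by (auto split: if_splits)
qed

text \<open>
  Since \<open>d\<close> divides \<open>(1 \<plusminus> d)\<^sup>2 - 1 = \<plusminus>d (2 \<plusminus> d)\<close>, this difference of unit squares is a non-unit, and it
  is nonzero modulo \<open>p d\<close> as soon as \<open>p\<close> does not divide \<open>2 \<plusminus> d\<close>. For one of the two signs \<open>p\<close> divides
  neither \<open>1 \<plusminus> d\<close> nor \<open>2 \<plusminus> d\<close>: otherwise \<open>p\<close> would divide the sum of one of \<open>1 + d, 2 + d\<close> and one of
  \<open>1 - d, 2 - d\<close>, which is 2, 3 or 4,
  and no prime above 3 divides these.
\<close>
lemma composite_nonunit_square_difference:
  assumes p: "Factorial_Ring.prime p" "p > 3" and d: "d > 1"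
  obtains x where "unit_square_difference (p * d) x" "\<not> coprime x (int (p * d))"
    "\<not> int (p * d) dvd x"
proof -
  have prime: "Factorial_Ring.prime (int p)"
    using p(1) by simp
  have small: "\<not> int p dvd k" if "k \<in> {2,3,4}" for k
  proof
    assume dvd: "int p dvd k"
    have "\<not> Factorial_Ring.prime (4::nat)"
      using prime_nat_not_dvd[of 4 2] by auto
    then have "p \<noteq> 4"
      using p(1) by metis
    then have "int p > 4"
      using p(2) by linarith
    then show False
      using zdvd_imp_le[OF dvd] that by auto
  qed
  have "\<exists>e \<in> {int d, - int d}. \<not> int p dvd 1 + e \<and> \<not> int p dvd 2 + e"
  proof (rule ccontr)
    assume "\<not> ?thesis"
    then obtain i j where ij: "i \<in> {1,2}" "j \<in> {1,2}"
      and "int p dvd i + int d" "int p dvd j - int d"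
      by auto
    then have "int p dvd (i + int d) + (j - int d)"
      using dvd_add by blast
    then show False
      using small[of "i + j"] ij by auto
  qed
  then obtain e where e: "e = int d \<or> e = - int d" "\<not> int p dvd 1 + e" "\<not> int p dvd 2 + e"
    by blast
  let ?x = "(1 + e)\<^sup>2 - 1"
  have x: "?x = e * (2 + e)"
    by (simp add: power2_eq_square algebra_simps)
  have "coprime (1 + e) e"
    by (rule coprimeI) (metis dvd_add_left_iff)
  then have "coprime (1 + e) (int d)"
    using e(1) by auto
  moreover have "coprime (1 + e) (int p)"
    using prime e(2) prime_imp_coprime coprime_commute by metis
  ultimately have "coprime (1 + e) (int (p * d))"
    by simp
  then have "unit_square_difference (p * d) ?x"
    unfolding unit_square_difference_def
    by (intro exI[of _ 1] exI[of _ "1 + e"]) simp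
  moreover have "\<not> coprime ?x (int (p * d))"
  proof
    assume "coprime ?x (int (p * d))"
    moreover have "int d dvd ?x"
      using e(1) by (auto simp: x)
    ultimately have "is_unit (int d)"
      by (meson coprime_common_divisor dvd_triv_right of_nat_dvd_iff)
    then show False
      using d by simp
  qed
  moreover have "\<not> int (p * d) dvd ?x"
  proof
    assume "int (p * d) dvd ?x"
    then have "e * int p dvd e * (2 + e)"
      using e(1) by (auto simp: x mult.commute)
    then show False
      using e d by (auto simp: dvd_times_left_cancel_iff)
  qed
  ultimately show ?thesis
    by (rule that)
qed

text \<open>
  The bound 7 is what makes the numbers 3, 4 and 5 units. They serve the two unit classes
  \<open>x \<equiv> \<plusminus>1\<close>, where one of \<open>x + 1\<close> and \<open>x - 1\<close> vanishes and \<open>4 x = (x + 1)\<^sup>2 - (x - 1)\<^sup>2\<close> is of no use.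
\<close>
lemma prime_ge_7_square_difference:
  assumes p: "Factorial_Ring.prime p" "p \<ge> 7"
  shows "unit_square_difference p x"
proof -
  have prime: "Factorial_Ring.prime (int p)"
    using p(1) by simp
  have co: "coprime y (int p)" if "\<not> int p dvd y" for y
    using prime that prime_imp_coprime coprime_commute by metis
  have small: "coprime k (int p)" if "k \<in> {2,3,4,5}" for k
  proof (rule co)
    show "\<not> int p dvd k"
      using zdvd_imp_le[of "int p" k] that p(2) by auto
  qed
  have I: "unit_square_difference p x" if "coprime u (int p)" "coprime v (int p)" "coprime w (int p)"
    "int p dvd x * u\<^sup>2 - (v\<^sup>2 - w\<^sup>2)" for u v w
    using that unfolding unit_square_difference_def cong_iff_dvd_diff by blast
  consider "int p dvd x - 1" | "int p dvd x + 1"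
    | "\<not> int p dvd x - 1" "\<not> int p dvd x + 1"
    by blast
  then show ?thesis
  proof cases
    case 1
    then have "int p dvd (x - 1) * 16"
      by (rule dvd_mult2)
    then show ?thesis
      by (intro I[of 4 5 3] small) (simp_all add: algebra_simps)
  next
    case 2
    then have "int p dvd (x + 1) * 16"
      by (rule dvd_mult2)
    then show ?thesis
      by (intro I[of 4 3 5] small) (simp_all add: algebra_simps)
  next
    case 3
    have "x * 2\<^sup>2 - ((x + 1)\<^sup>2 - (x - 1)\<^sup>2) = 0"
      by (simp add: power2_eq_square algebra_simps)
    then show ?thesis
      using 3 by (intro I[of 2 "x + 1" "x - 1"] small co) simp_all
  qed
qed

section \<open>Hyperbolicity\<close>

theorem corollary5p14:
  fixes n :: nat
  assumes "n \<ge> 1"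
    and "hyperfield_with_induced_ops (M_mod n) (U_mod n)"
  shows "hyperbolic (induced (M_mod n) (U_mod n)) \<longleftrightarrow> Factorial_Ring.prime n \<and> n \<ge> 7"
proof
  assume "hyperbolic (induced (M_mod n) (U_mod n))"
  then have one: "unit_square_difference n 1"
    using hyperbolic_U_mod_iff[OF assms(2)] by simp
  have "n > 1"
    using assms by (rule hyperfield_U_mod_imp_gt_1[rotated])
  then obtain p where p: "Factorial_Ring.prime p" "p dvd n"
    using prime_factor_nat[of n] by auto
  then obtain d where n: "n = p * d"
    by blast
  have "p \<ge> 7"
    using unit_pythagorean_imp_prime_ge_7[OF one p] .
  have "\<not> d > 1"
  proof
    assume "d > 1"
    then obtain x where "unit_square_difference n x" "\<not> coprime x (int n)" "\<not> int n dvd x"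
      using composite_nonunit_square_difference[OF p(1), of d] \<open>p \<ge> 7\<close> n by auto
    then show False
      using U_mod_closed_imp[OF assms(2)] by blast
  qed
  then have "n = p"
    using n \<open>n > 1\<close> by (cases d) auto
  then show "Factorial_Ring.prime n \<and> n \<ge> 7"
    using p \<open>p \<ge> 7\<close> by simp
next
  assume "Factorial_Ring.prime n \<and> n \<ge> 7"
  then show "hyperbolic (induced (M_mod n) (U_mod n))"
    using hyperbolic_U_mod_iff[OF assms(2)] prime_ge_7_square_difference by blast
qed

end
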